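(* Let $\{\mathcal{M}_k\}_{k=1}^L$ be a sequentially nested model class. Then the sequence of minimum risks $R(\boldsymbol\theta_1^* ),R(\boldsymbol\theta_2^* ),\dots,R(\boldsymbol\theta_L^* )$ and the sequence of minimum empirical risks $R_{emp}(S_n,\hat{\boldsymbol\theta}_1),R_{emp}(S_n,\hat{\boldsymbol\theta}_2),\dots,R_{emp}(S_n,\hat{\boldsymbol\theta}_L)$ are non-increasing.
   Context: Setting: $S_n=(\mathbf{z}_1,\dots,\mathbf{z}_n)$ consists of $n$ i.i.d. copies of a random element $\mathbf{Z}$ with unknown distribution. A model $\mathcal{M}_k=\{f_{\boldsymbol\theta_k}:\boldsymbol\theta_k\in\mathcal{H}_k\}$ is a set of functions (probability densities or conditional densities / predictors) with parameter space $\mathcal{H}_k$. The nonnegative loss $l(\mathbf{z},\boldsymbol\theta)$ stands for $l(f_{\boldsymbol\theta}(\mathbf{x}))$ (unsupervised, $\mathbf{z}=\mathbf{x}$) or $l(f_{\boldsymbol\theta}(\mathbf{x}),\mathbf{y})$ (supervised, $\mathbf{z}=(\mathbf{x},\mathbf{y})$), so it depends on $\boldsymbol\theta$ only through $f_{\boldsymbol\theta}$. The risk is $R(\boldsymbol\theta)=\mathbb{E}\{l(\mathbf{Z},\boldsymbol\theta)\}$ and the empirical risk is $R_{emp}(S_n,\boldsymbol\theta)=\frac1n\sum_{i=1}^n l(\mathbf{z}_i,\boldsymbol\theta)$. For each model, $\boldsymbol\theta_k^*\in\arg\min_{\boldsymbol\theta_k\in\mathcal{H}_k}R(\boldsymbol\theta_k)$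 and $\hat{\boldsymbol\theta}_k\in\arg\min_{\boldsymbol\theta_k\in\mathcal{H}_k}R_{emp}(S_n,\boldsymbol\theta_k)$ (minimizers are assumed to exist). Nested: $\mathcal{M}_i$ is nested in $\mathcal{M}_j$ if for all $\boldsymbol\theta_i\in\mathcal{H}_i$ there is $\boldsymbol\theta_j\in\mathcal{H}_j$ (not necessarily equal to $\boldsymbol\theta_i$) with $f_{\boldsymbol\theta_i}=f_{\boldsymbol\theta_j}$ (pointwise equality everywhere). A model class $\{\mathcal{M}_k\}_{k=1}^L$, $L>2$, is sequentially nested if $\mathcal{M}_i$ is nested in $\mathcal{M}_j$ for all $1\le i\le j\le L$. *)

theory Defs
  imports "HOL-Probability.Probability"
begin

text \<open>
  A parametric model is given by a parameter space \<open>H\<close> and a parametrisation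
  \<open>f\<close>, where \<open>f \<theta>\<close> is the function with parameter \<open>\<theta>\<close> on the input space \<open>X\<close>.
  The parameter type \<open>'p\<close> is shared by all models of a class, and parameter spaces of
  different dimensions are subsets of one large enough type (for instance \<open>real list\<close>).
  As the parametrisation may differ from model to model, the same element of \<open>'p\<close>
  may stand for different functions in different models.
\<close>

definition nested ::
  "'x set \<Rightarrow> 'p set \<Rightarrow> ('p \<Rightarrow> 'x \<Rightarrow> 'o) \<Rightarrow> 'p set \<Rightarrow> ('p \<Rightarrow> 'x \<Rightarrow> 'o) \<Rightarrow> bool" where
  "nested X H f H' f' \<longleftrightarrow> (\<forall>\<theta>\<in>H. \<exists>\<theta>'\<in>H'. \<forall>x\<in>X. f \<theta> x = f' \<theta>' x)"

definition sequentially_nested ::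
  "'x set \<Rightarrow> nat \<Rightarrow> (nat \<Rightarrow> 'p set) \<Rightarrow> (nat \<Rightarrow> 'p \<Rightarrow> 'x \<Rightarrow> 'o) \<Rightarrow> bool" where
  "sequentially_nested X L H f \<longleftrightarrow>
     L > 2 \<and> (\<forall>i j. 1 \<le> i \<and> i \<le> j \<and> j \<le> L \<longrightarrow> nested X (H i) (f i) (H j) (f j))"

text \<open>
  The loss of an observation \<open>z\<close> at parameter \<open>\<theta>\<close>: \<open>inp z\<close> is the part of the observation
  to which the model is applied, and the output is then compared with the observation.
  The two lemmas below recover the unsupervised loss \<open>l (f \<theta> x)\<close>, with \<open>z = x\<close>, and
  the supervised loss \<open>l (f \<theta> x) y\<close>, with \<open>z = (x, y)\<close>.  Values in \<^typ>\<open>ennreal\<close> express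
  nonnegativity and admit losses such as \<open>- log 0 = \<infinity>\<close>.
\<close>

definition model_loss ::
  "('z \<Rightarrow> 'x) \<Rightarrow> ('o \<Rightarrow> 'z \<Rightarrow> ennreal) \<Rightarrow> ('p \<Rightarrow> 'x \<Rightarrow> 'o) \<Rightarrow> 'z \<Rightarrow> 'p \<Rightarrow> ennreal" where
  "model_loss inp l f z \<theta> = l (f \<theta> (inp z)) z"

lemma model_loss_unsupervised: "model_loss (\<lambda>x. x) (\<lambda>u _. l u) f x \<theta> = l (f \<theta> x)"
  by (simp add: model_loss_def)

lemma model_loss_supervised: "model_loss fst (\<lambda>u (_, y). l u y) f (x, y) \<theta> = l (f \<theta> x) y"
  by (simp add: model_loss_def)

text \<open>
  The expectation of a nonnegative loss is a Lebesgue integral in \<open>[0, \<infinity>]\<close>.  The Bochner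
  integral would assign risk \<open>0\<close> to parameters whose loss is not integrable.
\<close>

definition risk :: "'w measure \<Rightarrow> ('w \<Rightarrow> 'z) \<Rightarrow> ('z \<Rightarrow> 'p \<Rightarrow> ennreal) \<Rightarrow> 'p \<Rightarrow> ennreal" where
  "risk M Z ls \<theta> = (\<integral>\<^sup>+\<omega>. ls (Z \<omega>) \<theta> \<partial>M)"

definition emp_risk :: "nat \<Rightarrow> (nat \<Rightarrow> 'z) \<Rightarrow> ('z \<Rightarrow> 'p \<Rightarrow> ennreal) \<Rightarrow> 'p \<Rightarrow> ennreal" where
  "emp_risk n s ls \<theta> = 1 / of_nat n * (\<Sum>i=1..n. ls (s i) \<theta>)"

definition iid_copies ::
  "'w measure \<Rightarrow> 'z measure \<Rightarrow> ('w \<Rightarrow> 'z) \<Rightarrow> nat \<Rightarrow> (nat \<Rightarrow> 'w \<Rightarrow> 'z) \<Rightarrow> bool" where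
  "iid_copies M N Z n S \<longleftrightarrow>
     prob_space.indep_vars M (\<lambda>_. N) S {1..n} \<and>
     (\<forall>i\<in>{1..n}. distr M N (S i) = distr M N Z)"

end

theory Submission
  imports Defs
begin

text \<open>Passing to a larger model can only lower a minimum. If model i is nested in model j, the
  function realised by the minimizer of model i is also realised by some parameter \<theta>' of
  model j. The loss depends on a parameter only through its function, so \<theta>' has the same risk
  and the same empirical risk, and the minimum over model j is at most this value.
  \<open>antimono_on_arg_min_value\<close> is the abstract form of this argument. Its objective
  \<open>g k\<close> varies with k because one parameter may stand for different functions in
  different models. \<open>nested_model_loss\<close> transfers nestedness to losses;
  \<open>risk_cong\<close> and \<open>emp_risk_cong\<close> carry equal losses over to the two
  objectives.\<close>

lemma antimono_on_arg_min_value: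
  fixes g :: "'i::preorder \<Rightarrow> 'p \<Rightarrow> 'v::linorder"
  assumes "\<And>k. k \<in> K \<Longrightarrow> is_arg_min (g k) (\<lambda>\<theta>. \<theta> \<in> H k) (m k)"
    and "\<And>i j \<theta>. i \<in> K \<Longrightarrow> j \<in> K \<Longrightarrow> i \<le> j \<Longrightarrow> \<theta> \<in> H i \<Longrightarrow> \<exists>\<theta>'\<in>H j. g j \<theta>' = g i \<theta>"
  shows "antimono_on K (\<lambda>k. g k (m k))"
proof (rule monotone_onI)
  fix i j assume ij: "i \<in> K" "j \<in> K" "i \<le> j"
  then have "m i \<in> H i"
    using assms(1) by (auto simp: is_arg_min_def)
  then obtain \<theta>' where "\<theta>' \<in> H j" "g j \<theta>' = g i (m i)"
    using assms(2) ij by blast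
  \<comment> \<open>\<open>is_arg_min\<close> only excludes strictly smaller values; in a linear
    order this makes \<open>g j (m j)\<close> a lower bound on \<open>H j\<close>, which is applied
    at \<theta>'.\<close>
  then show "g j (m j) \<le> g i (m i)"
    using assms(1)[OF ij(2)] by (metis is_arg_min_linorder)
qed

text \<open>The loss sees \<theta> only through \<open>f \<theta> (inp z)\<close>, and
  \<open>inp z\<close> lies in \<open>X\<close>, where the two functions agree. A single \<theta>'
  serves all z in \<open>A\<close> at once, so the equality survives integrating or summing over
  observations.\<close>

lemma nested_model_loss:
  assumes "nested X H f H' f'" "inp \<in> A \<rightarrow> X" "\<theta> \<in> H"
  shows "\<exists>\<theta>'\<in>H'. \<forall>z\<in>A. model_loss inp l f' z \<theta>' = model_loss inp l f z \<theta>"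
proof -
  obtain \<theta>' where "\<theta>' \<in> H'" "\<forall>x\<in>X. f \<theta> x = f' \<theta>' x"
    using assms(1,3) by (auto simp: nested_def)
  then show ?thesis
    using assms(2) by (intro bexI[of _ \<theta>']) (auto simp: model_loss_def Pi_iff)
qed

lemma risk_cong:
  assumes "Z \<in> space M \<rightarrow> A" "\<And>z. z \<in> A \<Longrightarrow> ls z \<theta> = ls' z \<theta>'"
  shows "risk M Z ls \<theta> = risk M Z ls' \<theta>'"
  unfolding risk_def using assms by (intro nn_integral_cong) auto

lemma emp_risk_cong:
  assumes "s \<in> {1..n} \<rightarrow> A" "\<And>z. z \<in> A \<Longrightarrow> ls z \<theta> = ls' z \<theta>'"
  shows "emp_risk n s ls \<theta> = emp_risk n s ls' \<theta>'"
  unfolding emp_risk_def using assms by (intro arg_cong2[where f = "(*)"] sum.cong) (auto simp: Pi_iff)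

theorem lemma1:
  fixes M :: "'w measure" and N :: "'z measure"
    and Z :: "'w \<Rightarrow> 'z" and n :: nat and S :: "nat \<Rightarrow> 'w \<Rightarrow> 'z"
    and X :: "'x set" and inp :: "'z \<Rightarrow> 'x" and l :: "'o \<Rightarrow> 'z \<Rightarrow> ennreal"
    and L :: nat and H :: "nat \<Rightarrow> 'p set" and f :: "nat \<Rightarrow> 'p \<Rightarrow> 'x \<Rightarrow> 'o"
    and \<theta>_star :: "nat \<Rightarrow> 'p" and \<theta>_hat :: "nat \<Rightarrow> 'w \<Rightarrow> 'p"
  assumes "prob_space M"
    and "Z \<in> measurable M N"
    and "n \<ge> 1"
    and "iid_copies M N Z n S"
    and "inp \<in> space N \<rightarrow> X"
    and "\<And>k \<theta>. k \<in> {1..L} \<Longrightarrow> \<theta> \<in> H k \<Longrightarrow>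
           (\<lambda>z. model_loss inp l (f k) z \<theta>) \<in> borel_measurable N"
    and "sequentially_nested X L H f"
    and "\<And>k. k \<in> {1..L} \<Longrightarrow>
           is_arg_min (risk M Z (model_loss inp l (f k))) (\<lambda>\<theta>. \<theta> \<in> H k) (\<theta>_star k)"
    and "\<And>k \<omega>. k \<in> {1..L} \<Longrightarrow> \<omega> \<in> space M \<Longrightarrow>
           is_arg_min (emp_risk n (\<lambda>i. S i \<omega>) (model_loss inp l (f k)))
             (\<lambda>\<theta>. \<theta> \<in> H k) (\<theta>_hat k \<omega>)"
  shows "antimono_on {1..L} (\<lambda>k. risk M Z (model_loss inp l (f k)) (\<theta>_star k)) \<and>
         (\<forall>\<omega>\<in>space M. antimono_on {1..L}
            (\<lambda>k. emp_risk n (\<lambda>i. S i \<omega>) (model_loss inp l (f k)) (\<theta>_hat k \<omega>)))"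
proof (intro conjI ballI)
  have nst: "nested X (H i) (f i) (H j) (f j)" if "i \<in> {1..L}" "j \<in> {1..L}" "i \<le> j" for i j
    using assms(7) that by (simp add: sequentially_nested_def)
  show "antimono_on {1..L} (\<lambda>k. risk M Z (model_loss inp l (f k)) (\<theta>_star k))"
  proof (rule antimono_on_arg_min_value[where H = H])
    fix i j \<theta> assume ij: "i \<in> {1..L}" "j \<in> {1..L}" "i \<le> j" and \<theta>: "\<theta> \<in> H i"
    obtain \<theta>' where \<theta>': "\<theta>' \<in> H j"
      and eq: "\<And>z. z \<in> space N \<Longrightarrow> model_loss inp l (f j) z \<theta>' = model_loss inp l (f i) z \<theta>"
      using nested_model_loss[where l = l, OF nst[OF ij] assms(5) \<theta>] by blast
    \<comment> \<open>The losses are known to agree only on \<open>space N\<close>; measurability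
      keeps every value of \<open>Z\<close> there.\<close>
    have "Z \<in> space M \<rightarrow> space N"
      using assms(2) by (simp add: measurable_def Pi_iff)
    then show "\<exists>\<theta>'\<in>H j. risk M Z (model_loss inp l (f j)) \<theta>' = risk M Z (model_loss inp l (f i)) \<theta>"
      using eq by (intro bexI[OF _ \<theta>'] risk_cong[where A = "space N"])
  qed (fact assms(8))
  fix \<omega> assume \<omega>: "\<omega> \<in> space M"
  \<comment> \<open>With \<omega> fixed the sample is a fixed finite sequence, so the same argument
    applies pointwise, for every outcome and not just almost surely.\<close>
  show "antimono_on {1..L}
    (\<lambda>k. emp_risk n (\<lambda>i. S i \<omega>) (model_loss inp l (f k)) (\<theta>_hat k \<omega>))"
  proof (rule antimono_on_arg_min_value[where H = H])
    fix i j \<theta> assume ij: "i \<in> {1..L}" "j \<in> {1..L}" "i \<le> j" and \<theta>: "\<theta> \<in> H i"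
    obtain \<theta>' where \<theta>': "\<theta>' \<in> H j"
      and eq: "\<And>z. z \<in> space N \<Longrightarrow> model_loss inp l (f j) z \<theta>' = model_loss inp l (f i) z \<theta>"
      using nested_model_loss[where l = l, OF nst[OF ij] assms(5) \<theta>] by blast
    \<comment> \<open>\<open>indep_vars\<close> includes measurability of each \<open>S i\<close>
      from \<open>M\<close> to \<open>N\<close>, which places all sample points in
      \<open>space N\<close>.\<close>
    have "(\<lambda>i. S i \<omega>) \<in> {1..n} \<rightarrow> space N"
      using assms(4) \<omega> by (auto simp: iid_copies_def prob_space.indep_vars_def[OF assms(1)]
          dest: measurable_space)
    then show "\<exists>\<theta>'\<in>H j. emp_risk n (\<lambda>i. S i \<omega>) (model_loss inp l (f j)) \<theta>'
        = emp_risk n (\<lambda>i. S i \<omega>) (model_loss inp l (f i)) \<theta>"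
      using eq by (intro bexI[OF _ \<theta>'] emp_risk_cong[where A = "space N"])
  qed (use assms(9) \<omega> in blast)
qed

end
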